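(* Let $\ell\ge 2$ be an integer and let $\mathfrak{S}_{\ell}$ be the variety of solvable groups of length at most $\ell$. Then every $\mathfrak{S}_{\ell}$-capable group is $\mathfrak{S}_{\ell-1}$-capable.
   Context: $\mathfrak{S}_\ell$ is defined by the word $\delta_\ell$, where $\delta_0=x$ and $\delta_\ell=[\delta_{\ell-1},\delta_{\ell-1}']$ with $\delta_{\ell-1}'$ a copy of $\delta_{\ell-1}$ in new variables; $\mathfrak{S}_1$ is the variety of abelian groups. For a set of words $V$ defining a variety $\mathfrak V$ and a group $E$, the marginal subgroup $V^*(E)$ is the set of all $a\in E$ such that $v(g_1,\dots,g_{i-1},g_ia,g_{i+1},\dots,g_n)=v(g_1,\dots,g_n)$ for all $v\in V$, all $g_1,\dots,g_n\in E$ and all $1\le i\le n$. A group $G$ is $\mathfrak V$-capable if there is a group $E$ with $G\cong E/V^*(E)$. *)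

theory Defs
  imports "HOL-Algebra.Algebra"
begin

section \<open>Group words and marginal subgroups\<close>

text \<open>
  A word is a group term; two terms that are equal in the free group have the same values in
  every group, so no reduction is needed. The variables of \<open>w\<close> are \<open>set_gword w\<close>, and
  \<open>map_gword\<close> renames them.
\<close>

datatype 'v gword = Var 'v | One | Mult "'v gword" "'v gword" | Inv "'v gword"

primrec eval_gword :: "('a, 'm) monoid_scheme \<Rightarrow> ('v \<Rightarrow> 'a) \<Rightarrow> 'v gword \<Rightarrow> 'a" where
  "eval_gword E g (Var i) = g i"
| "eval_gword E g One = \<one>\<^bsub>E\<^esub>"
| "eval_gword E g (Mult u w) = eval_gword E g u \<otimes>\<^bsub>E\<^esub> eval_gword E g w"
| "eval_gword E g (Inv u) = inv\<^bsub>E\<^esub> (eval_gword E g u)"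

definition comm_gword :: "'v gword \<Rightarrow> 'v gword \<Rightarrow> 'v gword" where
  "comm_gword u w = Mult (Mult (Inv u) (Inv w)) (Mult u w)"

definition marginal :: "nat gword set \<Rightarrow> ('a, 'm) monoid_scheme \<Rightarrow> 'a set" where
  "marginal V E = {a \<in> carrier E. \<forall>v\<in>V. \<forall>g \<in> UNIV \<rightarrow> carrier E. \<forall>i\<in>set_gword v.
     eval_gword E (g(i := g i \<otimes>\<^bsub>E\<^esub> a)) v = eval_gword E g v}"

text \<open>
  HOL has no quantification over types inside a formula, so the group \<open>E\<close> in the definition of
  capability needs a fixed type. The type \<open>'a + nat\<close> has cardinality \<open>max |'a| \<aleph>\<^sub>0\<close>, and by the
  Loewenheim-Skolem argument in \<open>capableI\<close> below this is no restriction: a witness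
  over any type whatsoever yields one over \<open>'a + nat\<close>.
\<close>

definition capable :: "nat gword set \<Rightarrow> ('a, 'm) monoid_scheme \<Rightarrow> bool" where
  "capable V G \<longleftrightarrow> (\<exists>E :: ('a + nat) monoid. group E \<and> G \<cong> E Mod marginal V E)"

text \<open>The word \<open>\<delta>\<^sub>l\<close> uses the variables \<open>0, \<dots>, 2\<^sup>l - 1\<close> (see \<open>set_delta_word\<close>).\<close>

primrec delta_word :: "nat \<Rightarrow> nat gword" where
  "delta_word 0 = Var 0"
| "delta_word (Suc l) =
     comm_gword (delta_word l) (map_gword (\<lambda>i. i + 2 ^ l) (delta_word l))"

definition solvable_words :: "nat \<Rightarrow> nat gword set" where
  "solvable_words l = {delta_word l}"


section \<open>The variables of \<open>\<delta>\<^sub>l\<close>\<close>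

lemma set_delta_word: "set_gword (delta_word l) = {..<2 ^ l}"
proof (induction l)
  case (Suc l)
  have "(\<lambda>i. i + 2 ^ l) ` {..<2 ^ l} = {2 ^ l..<2 ^ Suc l :: nat}"
  proof (intro equalityI subsetI)
    fix j :: nat assume "j \<in> {2 ^ l..<2 ^ Suc l}"
    then show "j \<in> (\<lambda>i. i + 2 ^ l) ` {..<2 ^ l}"
      by (intro image_eqI[of _ _ "j - 2 ^ l"]) auto
  qed auto
  then show ?case
    using Suc by (auto simp: comm_gword_def gword.set_map)
qed auto


section \<open>The marginal subgroup is normal\<close>

lemma eval_gword_closed:
  assumes "group E" "g \<in> UNIV \<rightarrow> carrier E"
  shows "eval_gword E g v \<in> carrier E"
proof -
  interpret group E by fact
  show ?thesis using assms(2) by (induction v) auto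
qed

lemma eval_gword_hom:
  assumes "group_hom E H h" "g \<in> UNIV \<rightarrow> carrier E"
  shows "h (eval_gword E g v) = eval_gword H (h \<circ> g) v"
proof -
  interpret group_hom E H h by fact
  have *: "eval_gword E g v \<in> carrier E" for v
    by (rule eval_gword_closed) (use assms in auto)
  show ?thesis using * by (induction v) auto
qed

lemma marginal_normal:
  fixes E (structure)
  assumes "group E"
  shows "marginal V E \<lhd> E"
proof -
  interpret group E by fact
  let ?M = "marginal V E"
  have M: "eval_gword E (g(i := g i \<otimes> a)) v = eval_gword E g v"
    if "a \<in> ?M" "v \<in> V" "g \<in> UNIV \<rightarrow> carrier E" "i \<in> set_gword v" for a v g i
    using that by (auto simp: marginal_def)
  have Mc: "a \<in> carrier E" if "a \<in> ?M" for a
    using that by (auto simp: marginal_def)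
  have MI: "a \<in> ?M" if "a \<in> carrier E"
    "\<And>v g i. v \<in> V \<Longrightarrow> g \<in> UNIV \<rightarrow> carrier E \<Longrightarrow> i \<in> set_gword v \<Longrightarrow>
       eval_gword E (g(i := g i \<otimes> a)) v = eval_gword E g v" for a
    using that by (auto simp: marginal_def)
  have upd: "g(i := x) \<in> UNIV \<rightarrow> carrier E" if "g \<in> UNIV \<rightarrow> carrier E" "x \<in> carrier E" for g :: "nat \<Rightarrow> _" and i x
    using that by auto
  show ?thesis
  proof (rule normal_invI, rule subgroupI)
    show "?M \<subseteq> carrier E" using Mc by auto
    have "\<one> \<in> ?M"
      by (rule MI) (auto simp: Pi_iff)
    then show "?M \<noteq> {}" by auto
  next
    fix a assume a: "a \<in> ?M"
    show "inv a \<in> ?M"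
    proof (rule MI)
      fix v and g :: "nat \<Rightarrow> _" and i assume *: "v \<in> V" "g \<in> UNIV \<rightarrow> carrier E" "i \<in> set_gword v"
      have gi: "g i \<in> carrier E" using * by auto
      let ?g = "g(i := g i \<otimes> inv a)"
      have "?g \<in> UNIV \<rightarrow> carrier E" using gi Mc[OF a] * by (intro upd) auto
      from M[OF a *(1) this *(3)]
      show "eval_gword E ?g v = eval_gword E g v"
        using gi Mc[OF a] by (simp add: m_assoc)
    qed (use Mc[OF a] in auto)
  next
    fix a b assume a: "a \<in> ?M" and b: "b \<in> ?M"
    show "a \<otimes> b \<in> ?M"
    proof (rule MI)
      fix v and g :: "nat \<Rightarrow> _" and i assume *: "v \<in> V" "g \<in> UNIV \<rightarrow> carrier E" "i \<in> set_gword v"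
      have gi: "g i \<in> carrier E" using * by auto
      let ?g = "g(i := g i \<otimes> a)"
      have "?g \<in> UNIV \<rightarrow> carrier E" using gi Mc[OF a] * by (intro upd) auto
      from M[OF b *(1) this *(3)] M[OF a *]
      show "eval_gword E (g(i := g i \<otimes> (a \<otimes> b))) v = eval_gword E g v"
        using gi Mc[OF a] Mc[OF b] by (simp add: m_assoc)
    qed (use Mc[OF a] Mc[OF b] in auto)
  next
    fix x a assume x: "x \<in> carrier E" and a: "a \<in> ?M"
    note ac = Mc[OF a]
    define c where "c = (\<lambda>y. inv x \<otimes> y \<otimes> x)"
    have "c \<in> hom E E"
    proof (rule homI)
      fix y z assume yz: "y \<in> carrier E" "z \<in> carrier E"
      have "x \<otimes> (inv x \<otimes> (z \<otimes> x)) = z \<otimes> x"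
        using x yz by (simp flip: m_assoc)
      then show "c (y \<otimes> z) = c y \<otimes> c z"
        using x yz by (simp add: c_def m_assoc)
    qed (use x in \<open>simp add: c_def\<close>)
    then have hom: "group_hom E E c"
      by (simp add: group_hom_def group_hom_axioms_def is_group)
    have cc: "c y \<in> carrier E" if "y \<in> carrier E" for y
      using that x by (simp add: c_def)
    have c_inj: "y = z" if "y \<in> carrier E" "z \<in> carrier E" "c y = c z" for y z
      using that x by (simp add: c_def)
    show "x \<otimes> a \<otimes> inv x \<in> ?M"
    proof (rule MI)
      fix v and g :: "nat \<Rightarrow> _" and i assume *: "v \<in> V" "g \<in> UNIV \<rightarrow> carrier E" "i \<in> set_gword v"
      have gi: "g i \<in> carrier E" using * by auto
      let ?g = "g(i := g i \<otimes> (x \<otimes> a \<otimes> inv x))"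
      have g': "?g \<in> UNIV \<rightarrow> carrier E" using gi ac x * by (intro upd) auto
      have cg: "c \<circ> g \<in> UNIV \<rightarrow> carrier E" using * cc by (auto simp: Pi_iff)
      have eq: "c \<circ> ?g = (c \<circ> g)(i := (c \<circ> g) i \<otimes> a)"
        using gi x ac by (auto simp: fun_eq_iff c_def m_assoc)
      have "c (eval_gword E ?g v) = eval_gword E ((c \<circ> g)(i := (c \<circ> g) i \<otimes> a)) v"
        using eval_gword_hom[OF hom g'] eq by simp
      also have "\<dots> = eval_gword E (c \<circ> g) v"
        using M[OF a *(1) cg *(3)] .
      also have "\<dots> = c (eval_gword E g v)"
        using eval_gword_hom[OF hom *(2)] by simp
      finally show "eval_gword E ?g v = eval_gword E g v"
        by (rule c_inj[OF eval_gword_closed[OF assms g'] eval_gword_closed[OF assms *(2)]])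
    qed (use x ac in auto)
  qed
qed


section \<open>Witnesses of capability over arbitrary types\<close>

lemma small_closure:
  fixes op :: "nat \<Rightarrow> 'e \<Rightarrow> 'e \<Rightarrow> 'e"
  assumes inf: "infinite (UNIV :: 'k set)" and B: "|B| \<le>o |UNIV :: 'k set|"
  obtains S where "B \<subseteq> S" "\<And>n x y. x \<in> S \<Longrightarrow> y \<in> S \<Longrightarrow> op n x y \<in> S"
    "|S| \<le>o |UNIV :: 'k set|"
    "\<And>C. B \<subseteq> C \<Longrightarrow> (\<And>n x y. x \<in> C \<Longrightarrow> y \<in> C \<Longrightarrow> op n x y \<in> C) \<Longrightarrow> S \<subseteq> C"
proof -
  let ?K = "UNIV :: 'k set"
  define F where "F = rec_nat B (\<lambda>_ T. T \<union> (\<Union>n. (\<lambda>(x, y). op n x y) ` (T \<times> T)))"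
  have F0: "F 0 = B"
    and FS: "F (Suc k) = F k \<union> (\<Union>n. (\<lambda>(x, y). op n x y) ` (F k \<times> F k))" for k
    by (simp_all add: F_def)
  have nat: "|UNIV :: nat set| \<le>o |?K|"
    using inf infinite_iff_card_of_nat by blast
  have card: "|F k| \<le>o |?K|" for k
  proof (induction k)
    case (Suc k)
    have "|(\<lambda>(x, y). op n x y) ` (F k \<times> F k)| \<le>o |?K|" for n
      by (rule ordLeq_transitive[OF card_of_image])
        (rule card_of_Times_ordLeq_infinite_Field, use Suc inf in auto)
    then have "|\<Union>n. (\<lambda>(x, y). op n x y) ` (F k \<times> F k)| \<le>o |?K|"
      using nat inf by (intro card_of_UNION_ordLeq_infinite) auto
    then show ?case
      unfolding FS using Suc inf by (intro card_of_Un_ordLeq_infinite_Field) auto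
  qed (use B F0 in auto)
  have mono: "F j \<subseteq> F k" if "j \<le> k" for j k
    using that by (induction rule: dec_induct) (auto simp: FS)
  show thesis
  proof (rule that[of "\<Union>k. F k"])
    show "B \<subseteq> (\<Union>k. F k)" using F0 by blast
    show "|\<Union>k. F k| \<le>o |?K|"
      using nat inf card by (intro card_of_UNION_ordLeq_infinite) auto
    fix n x y assume "x \<in> (\<Union>k. F k)" "y \<in> (\<Union>k. F k)"
    then obtain j k where "x \<in> F j" "y \<in> F k" by auto
    then have "x \<in> F (max j k)" "y \<in> F (max j k)"
      using mono[of j "max j k"] mono[of k "max j k"] by auto
    then have "op n x y \<in> F (Suc (max j k))" by (auto simp: FS)
    then show "op n x y \<in> (\<Union>k. F k)" by blast
  next
    fix C assume C: "B \<subseteq> C" "\<And>n x y. x \<in> C \<Longrightarrow> y \<in> C \<Longrightarrow> op n x y \<in> C"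
    have "F k \<subseteq> C" for k
    proof (induction k)
      case (Suc k)
      then show ?case using C(2) by (fastforce simp: FS)
    qed (use C(1) F0 in simp)
    then show "(\<Union>k. F k) \<subseteq> C" by blast
  qed
qed

lemma eval_gword_subgroup:
  assumes "group E" "subgroup S E" "g \<in> UNIV \<rightarrow> S"
  shows "eval_gword (E\<lparr>carrier := S\<rparr>) g v = eval_gword E g v"
proof -
  have "group_hom (E\<lparr>carrier := S\<rparr>) E id"
    using assms(1,2) group.canonical_inj_is_hom by blast
  from eval_gword_hom[OF this, of g v] assms(3) show ?thesis by simp
qed

theorem capableI:
  fixes G :: "('a, 'm) monoid_scheme" and E :: "('e, 'n) monoid_scheme"
  assumes G: "group G" and E: "group E" and iso: "G \<cong> E Mod marginal V E"
  shows "capable V G"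
proof -
  interpret E: group E by fact
  interpret G: group G by fact
  let ?M = "marginal V E"
  interpret M: normal ?M E by (rule marginal_normal[OF E])
  have "E Mod ?M \<cong> G" using G.iso_sym[OF iso] .
  then obtain f where f: "f \<in> iso (E Mod ?M) G" unfolding is_iso_def by auto
  define h where "h = f \<circ> (\<lambda>a. ?M #>\<^bsub>E\<^esub> a)"
  have h_hom: "h \<in> hom E G"
    unfolding h_def using M.r_coset_hom_Mod f by (auto intro: hom_compose simp: iso_def)
  then interpret h: group_hom E G h by unfold_locales
  have h_surj: "h ` carrier E = carrier G"
  proof -
    have "(\<lambda>a. ?M #>\<^bsub>E\<^esub> a) ` carrier E = carrier (E Mod ?M)"
      by (auto simp: FactGroup_def RCOSETS_def)
    then show ?thesis
      unfolding h_def image_comp[symmetric] using f by (simp add: iso_iff)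
  qed
  have h_ker: "h a = \<one>\<^bsub>G\<^esub> \<longleftrightarrow> a \<in> ?M" if a: "a \<in> carrier E" for a
  proof -
    have "h a = \<one>\<^bsub>G\<^esub> \<longleftrightarrow> h a = h \<one>\<^bsub>E\<^esub>" by simp
    also have "\<dots> \<longleftrightarrow> ?M #>\<^bsub>E\<^esub> a = ?M #>\<^bsub>E\<^esub> \<one>\<^bsub>E\<^esub>"
    proof -
      have "inj_on f (carrier (E Mod ?M))" using f by (simp add: iso_iff)
      moreover have "?M #>\<^bsub>E\<^esub> b \<in> carrier (E Mod ?M)" if "b \<in> carrier E" for b
        using that by (auto simp: FactGroup_def RCOSETS_def)
      ultimately show ?thesis
        using a by (simp add: h_def inj_on_eq_iff)
    qed
    also have "\<dots> \<longleftrightarrow> a \<in> ?M"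
      using a M.subset M.subgroup_axioms E.coset_join1[of ?M a] E.coset_join2[of a ?M]
        E.coset_mult_one[of ?M] by metis
    finally show ?thesis .
  qed

  have "\<exists>w. \<forall>a\<in>carrier E. (\<forall>j. w a j \<in> carrier E) \<and>
     (a \<notin> ?M \<longrightarrow> (\<exists>v\<in>V. \<exists>i\<in>set_gword v.
        eval_gword E ((w a)(i := w a i \<otimes>\<^bsub>E\<^esub> a)) v \<noteq> eval_gword E (w a) v))"
    (is "\<exists>w. \<forall>a\<in>_. ?P a (w a)")
  proof (rule bchoice, rule ballI)
    fix a assume a: "a \<in> carrier E"
    show "\<exists>g. ?P a g"
    proof (cases "a \<in> ?M")
      case True
      then show ?thesis by (intro exI[of _ "\<lambda>_. \<one>\<^bsub>E\<^esub>"]) auto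
    next
      case False
      then obtain v g i where "v \<in> V" "g \<in> UNIV \<rightarrow> carrier E" "i \<in> set_gword v"
        "eval_gword E (g(i := g i \<otimes>\<^bsub>E\<^esub> a)) v \<noteq> eval_gword E g v"
        using a unfolding marginal_def by blast
      then show ?thesis by (intro exI[of _ g]) blast
    qed
  qed
  then obtain w where wc: "\<And>a j. a \<in> carrier E \<Longrightarrow> w a j \<in> carrier E"
    and w: "\<And>a. a \<in> carrier E \<Longrightarrow> a \<notin> ?M \<Longrightarrow> \<exists>v\<in>V. \<exists>i\<in>set_gword v.
        eval_gword E ((w a)(i := w a i \<otimes>\<^bsub>E\<^esub> a)) v \<noteq> eval_gword E (w a) v"
    by blast

  define B where "B = insert \<one>\<^bsub>E\<^esub> (inv_into (carrier E) h ` carrier G)"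
  define op where "op = (\<lambda>n x y. case n of 0 \<Rightarrow> x \<otimes>\<^bsub>E\<^esub> y
      | Suc m \<Rightarrow> (case m of 0 \<Rightarrow> inv\<^bsub>E\<^esub> x | Suc j \<Rightarrow> w x j))"
  let ?K = "UNIV :: ('a + nat) set"
  have inf: "infinite ?K" by simp
  have "B \<subseteq> (\<lambda>s. case s of Inl x \<Rightarrow> inv_into (carrier E) h x | Inr _ \<Rightarrow> \<one>\<^bsub>E\<^esub>) ` ?K"
    unfolding B_def by (force simp: image_iff split: sum.splits)
  then have "|B| \<le>o |?K|"
    by (rule ordLeq_transitive[OF card_of_mono1 card_of_image])
  then obtain S where S:
    "B \<subseteq> S" "\<And>n x y. x \<in> S \<Longrightarrow> y \<in> S \<Longrightarrow> op n x y \<in> S" "|S| \<le>o |?K|"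
    "\<And>C. B \<subseteq> C \<Longrightarrow> (\<And>n x y. x \<in> C \<Longrightarrow> y \<in> C \<Longrightarrow> op n x y \<in> C) \<Longrightarrow> S \<subseteq> C"
    by (rule small_closure[OF inf, where op = op]) blast
  have SE: "S \<subseteq> carrier E"
  proof (rule S(4))
    show "B \<subseteq> carrier E"
      using h_surj by (auto simp: B_def intro!: inv_into_into)
  qed (auto simp: op_def wc split: nat.splits)
  have S_mult: "x \<otimes>\<^bsub>E\<^esub> y \<in> S" if "x \<in> S" "y \<in> S" for x y
    using S(2)[OF that, of 0] by (simp add: op_def)
  have S_inv: "inv\<^bsub>E\<^esub> x \<in> S" if "x \<in> S" for x
    using S(2)[OF that that, of 1] by (simp add: op_def)
  have S_w: "w x j \<in> S" if "x \<in> S" for x j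
    using S(2)[OF that that, of "Suc (Suc j)"] by (simp add: op_def)
  have S_sub: "subgroup S E"
    using SE S(1) S_mult S_inv by (intro E.subgroupI) (auto simp: B_def)
  define E1 where "E1 = E\<lparr>carrier := S\<rparr>"
  have E1: "group E1" unfolding E1_def using S_sub by (rule E.subgroup_imp_group)
  have ev: "eval_gword E1 g v = eval_gword E g v" if "g \<in> UNIV \<rightarrow> S" for g and v :: "nat gword"
    unfolding E1_def using E S_sub that by (rule eval_gword_subgroup)
  have mult1: "x \<otimes>\<^bsub>E1\<^esub> y = x \<otimes>\<^bsub>E\<^esub> y" for x y by (simp add: E1_def)
  have marg1: "marginal V E1 = ?M \<inter> S"
  proof (intro equalityI subsetI)
    fix a assume a: "a \<in> ?M \<inter> S"
    show "a \<in> marginal V E1"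
      unfolding marginal_def
    proof (intro CollectI conjI ballI)
      fix v and g :: "nat \<Rightarrow> _" and i assume *: "v \<in> V" "g \<in> UNIV \<rightarrow> carrier E1" "i \<in> set_gword v"
      have g: "g \<in> UNIV \<rightarrow> S" "g \<in> UNIV \<rightarrow> carrier E" using * SE by (auto simp: E1_def)
      have g': "g(i := g i \<otimes>\<^bsub>E\<^esub> a) \<in> UNIV \<rightarrow> S" using g a S_mult by (auto simp: Pi_iff)
      have "eval_gword E (g(i := g i \<otimes>\<^bsub>E\<^esub> a)) v = eval_gword E g v"
        using a g(2) *(1,3) unfolding marginal_def by blast
      then show "eval_gword E1 (g(i := g i \<otimes>\<^bsub>E1\<^esub> a)) v = eval_gword E1 g v"
        by (simp add: ev[OF g(1)] ev[OF g'] mult1)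
    qed (use a in \<open>auto simp: E1_def\<close>)
  next
    fix a assume a: "a \<in> marginal V E1"
    then have aS: "a \<in> S" by (auto simp: marginal_def E1_def)
    have "a \<in> ?M"
    proof (rule ccontr)
      assume "a \<notin> ?M"
      then obtain v i where vi: "v \<in> V" "i \<in> set_gword v"
        "eval_gword E ((w a)(i := w a i \<otimes>\<^bsub>E\<^esub> a)) v \<noteq> eval_gword E (w a) v"
        using w aS SE by blast
      have wS: "w a \<in> UNIV \<rightarrow> S" using S_w aS by (auto simp: Pi_iff)
      then have wS': "(w a)(i := w a i \<otimes>\<^bsub>E\<^esub> a) \<in> UNIV \<rightarrow> S" using S_mult aS by (auto simp: Pi_iff)
      have "eval_gword E1 ((w a)(i := w a i \<otimes>\<^bsub>E1\<^esub> a)) v \<noteq> eval_gword E1 (w a) v"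
        using vi(3) by (simp add: ev[OF wS] ev[OF wS'] mult1)
      moreover have "w a \<in> UNIV \<rightarrow> carrier E1" using wS by (simp add: E1_def)
      ultimately show False
        using a vi(1,2) unfolding marginal_def by blast
    qed
    then show "a \<in> ?M \<inter> S" using aS by auto
  qed

  from S(3) obtain k :: "'e \<Rightarrow> 'a + nat" where k: "inj_on k S"
    using card_of_ordLeq[of S ?K] by auto
  define d where "d = inv_into S k"
  define E2 :: "('a + nat) monoid" where
    "E2 = \<lparr>carrier = k ` S, monoid.mult = \<lambda>x y. k (d x \<otimes>\<^bsub>E\<^esub> d y), one = k \<one>\<^bsub>E\<^esub>\<rparr>"
  have dk: "d (k x) = x" if "x \<in> S" for x using k that by (simp add: d_def)
  have k_iso: "k \<in> iso E1 E2"
    using k S_mult by (auto simp: iso_def hom_def bij_betw_def E1_def E2_def dk)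
  have E2: "group E2"
  proof -
    have "group (E2\<lparr>one := k \<one>\<^bsub>E1\<^esub>\<rparr>)"
      using group.iso_imp_img_group[OF E1 k_iso] .
    then show ?thesis by (simp add: E1_def E2_def)
  qed
  interpret E1: group E1 by (rule E1)
  interpret E2: group E2 by (rule E2)
  have d_iso: "d \<in> iso E2 E1"
    using E1.iso_set_sym[OF k_iso] by (simp add: d_def E1_def)
  have k_hom: "group_hom E1 E2 k" and d_hom: "group_hom E2 E1 d"
    using k_iso d_iso by (auto simp: iso_def intro!: group_hom.intro group_hom_axioms.intro E1 E2)
  have d_c: "d x \<in> S" "k (d x) = x" if "x \<in> carrier E2" for x
    using that by (auto simp: E2_def dk)
  have k_c: "k x \<in> carrier E2" if "x \<in> S" for x
    using that by (auto simp: E2_def)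
  have marg2: "x \<in> marginal V E2 \<longleftrightarrow> d x \<in> marginal V E1" if x: "x \<in> carrier E2" for x
  proof
    assume L: "x \<in> marginal V E2"
    show "d x \<in> marginal V E1"
      unfolding marginal_def
    proof (intro CollectI conjI ballI)
      fix v and g :: "nat \<Rightarrow> _" and i assume *: "v \<in> V" "g \<in> UNIV \<rightarrow> carrier E1" "i \<in> set_gword v"
      have gS: "g j \<in> S" for j using * by (auto simp: E1_def)
      have g': "g(i := g i \<otimes>\<^bsub>E1\<^esub> d x) \<in> UNIV \<rightarrow> carrier E1"
        using gS d_c[OF x] S_mult by (auto simp: E1_def Pi_iff)
      have eq: "k \<circ> (g(i := g i \<otimes>\<^bsub>E1\<^esub> d x)) = (k \<circ> g)(i := (k \<circ> g) i \<otimes>\<^bsub>E2\<^esub> x)"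
        using gS d_c[OF x] by (auto simp: fun_eq_iff E1_def E2_def dk)
      have kg: "k \<circ> g \<in> UNIV \<rightarrow> carrier E2" using gS k_c by auto
      have "k (eval_gword E1 (g(i := g i \<otimes>\<^bsub>E1\<^esub> d x)) v) = k (eval_gword E1 g v)"
        unfolding eval_gword_hom[OF k_hom g'] eval_gword_hom[OF k_hom *(2)] eq
        using L *(1,3) kg unfolding marginal_def by blast
      moreover have "eval_gword E1 (g(i := g i \<otimes>\<^bsub>E1\<^esub> d x)) v \<in> S" "eval_gword E1 g v \<in> S"
        using eval_gword_closed[OF E1 g'] eval_gword_closed[OF E1 *(2)] by (auto simp: E1_def)
      ultimately show "eval_gword E1 (g(i := g i \<otimes>\<^bsub>E1\<^esub> d x)) v = eval_gword E1 g v"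
        using k by (auto dest: inj_onD)
    qed (use d_c[OF x] in \<open>auto simp: E1_def\<close>)
  next
    assume L: "d x \<in> marginal V E1"
    show "x \<in> marginal V E2"
      unfolding marginal_def
    proof (intro CollectI conjI ballI)
      fix v and g :: "nat \<Rightarrow> _" and i assume *: "v \<in> V" "g \<in> UNIV \<rightarrow> carrier E2" "i \<in> set_gword v"
      have gS: "g j \<in> carrier E2" for j using * by auto
      have g': "g(i := g i \<otimes>\<^bsub>E2\<^esub> x) \<in> UNIV \<rightarrow> carrier E2"
        using gS x by (auto simp: Pi_iff)
      have eq: "d \<circ> (g(i := g i \<otimes>\<^bsub>E2\<^esub> x)) = (d \<circ> g)(i := (d \<circ> g) i \<otimes>\<^bsub>E1\<^esub> d x)"
        using gS x group_hom.hom_mult[OF d_hom] by (auto simp: fun_eq_iff)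
      have dg: "d \<circ> g \<in> UNIV \<rightarrow> carrier E1" using gS d_c by (auto simp: E1_def Pi_iff)
      have "d (eval_gword E2 (g(i := g i \<otimes>\<^bsub>E2\<^esub> x)) v) = d (eval_gword E2 g v)"
        unfolding eval_gword_hom[OF d_hom g'] eval_gword_hom[OF d_hom *(2)] eq
        using L *(1,3) dg unfolding marginal_def by blast
      then show "eval_gword E2 (g(i := g i \<otimes>\<^bsub>E2\<^esub> x)) v = eval_gword E2 g v"
        using d_c(2) eval_gword_closed[OF E2 g'] eval_gword_closed[OF E2 *(2)] by metis
    qed (use x in auto)
  qed

  have hd_hom: "h \<circ> d \<in> hom E2 G"
    using h_hom SE d_iso by (auto simp: hom_def iso_def E1_def Pi_iff subset_iff)
  then interpret hd: group_hom E2 G "h \<circ> d" by unfold_locales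
  have "(h \<circ> d) ` carrier E2 = h ` S"
    by (force simp: E2_def image_comp dk image_iff)
  also have "\<dots> = carrier G"
  proof
    show "h ` S \<subseteq> carrier G" using SE h_surj by auto
    show "carrier G \<subseteq> h ` S"
    proof
      fix y assume y: "y \<in> carrier G"
      then have "h (inv_into (carrier E) h y) = y" using h_surj f_inv_into_f by metis
      moreover have "inv_into (carrier E) h y \<in> S" using y S(1) by (auto simp: B_def)
      ultimately show "y \<in> h ` S" by (metis imageI)
    qed
  qed
  finally have "E2 Mod kernel E2 G (h \<circ> d) \<cong> G"
    by (rule hd.FactGroup_iso)
  moreover have "kernel E2 G (h \<circ> d) = marginal V E2"
  proof -
    have "(h \<circ> d) x = \<one>\<^bsub>G\<^esub> \<longleftrightarrow> x \<in> marginal V E2" if x: "x \<in> carrier E2" for x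
      using h_ker[of "d x"] d_c[OF x] SE by (auto simp: marg2[OF x] marg1)
    moreover have "marginal V E2 \<subseteq> carrier E2" by (auto simp: marginal_def)
    ultimately show ?thesis by (auto simp: kernel_def)
  qed
  ultimately have *: "E2 Mod marginal V E2 \<cong> G" by simp
  have "group (E2 Mod marginal V E2)"
    using marginal_normal[OF E2] by (rule normal.factorgroup_is_group)
  then have "G \<cong> E2 Mod marginal V E2"
    using * by (rule group.iso_sym)
  then show ?thesis
    unfolding capable_def using E2 by blast
qed

end

theory Submission
  imports Defs
begin

text \<open>
  Let \<open>C\<close> be the centralizer in \<open>E\<close> of the values of a word \<open>w\<close>, and let \<open>w'\<close> be a copy of \<open>w\<close> in
  new variables. Two elements \<open>u\<close>, \<open>v\<close> satisfy \<open>[u, z] = [v, z]\<close> for every value \<open>z\<close> of \<open>w\<close> if and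
  only if they are congruent modulo \<open>C\<close>. Hence the marginal subgroup of \<open>[w, w']\<close> in \<open>E\<close> is the
  preimage of the marginal subgroup of \<open>w\<close> in \<open>E / C\<close>, and the two quotients agree.
\<close>

section \<open>Values of words and of commutator words\<close>

lemma eval_gword_cong:
  "(\<And>i. i \<in> set_gword v \<Longrightarrow> g i = h i) \<Longrightarrow> eval_gword E g v = eval_gword E h v"
  by (induction v) auto

lemma eval_map_gword: "eval_gword E g (map_gword f v) = eval_gword E (g \<circ> f) v"
  by (induction v) auto

lemma set_comm_gword: "set_gword (comm_gword u w) = set_gword u \<union> set_gword w"
  by (auto simp: comm_gword_def)

definition gcomm :: "('a, 'm) monoid_scheme \<Rightarrow> 'a \<Rightarrow> 'a \<Rightarrow> 'a" where
  "gcomm E x y = (inv\<^bsub>E\<^esub> x \<otimes>\<^bsub>E\<^esub> inv\<^bsub>E\<^esub> y) \<otimes>\<^bsub>E\<^esub> (x \<otimes>\<^bsub>E\<^esub> y)"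

lemma eval_comm_gword:
  "eval_gword E g (comm_gword u w) = gcomm E (eval_gword E g u) (eval_gword E g w)"
  by (simp add: comm_gword_def gcomm_def)

definition word_centralizer :: "('a, 'm) monoid_scheme \<Rightarrow> nat gword \<Rightarrow> 'a set" where
  "word_centralizer E w = {c \<in> carrier E. \<forall>g \<in> UNIV \<rightarrow> carrier E.
     c \<otimes>\<^bsub>E\<^esub> eval_gword E g w = eval_gword E g w \<otimes>\<^bsub>E\<^esub> c}"

section \<open>Commutators and the centralizer of the word values\<close>

context group
begin

lemma mult_inv_cancel:
  assumes "x \<in> carrier G" "y \<in> carrier G"
  shows "x \<otimes> (inv x \<otimes> y) = y" "inv x \<otimes> (x \<otimes> y) = y"
  using assms by (simp_all flip: m_assoc)

lemma commute_inv:
  assumes "x \<in> carrier G" "y \<in> carrier G" "x \<otimes> y = y \<otimes> x"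
  shows "inv x \<otimes> y = y \<otimes> inv x"
proof -
  have "inv x \<otimes> (x \<otimes> y) \<otimes> inv x = inv x \<otimes> (y \<otimes> x) \<otimes> inv x"
    using assms(3) by simp
  then show ?thesis using assms(1,2) by (simp add: m_assoc mult_inv_cancel)
qed

text \<open>Since \<open>[x, z]\<close> is the conjugate of \<open>inv z\<close> by \<open>x\<close>
  times \<open>z\<close>, cancelling \<open>z\<close> and inverting leaves the equation that the
  conjugates of \<open>z\<close> by \<open>x\<close> and by \<open>y\<close> agree, which says that
  \<open>x \<otimes> inv y\<close> centralizes \<open>z\<close>.\<close>

lemma gcomm_eq_left_iff:
  assumes x: "x \<in> carrier G" and y: "y \<in> carrier G" and z: "z \<in> carrier G"
  shows "gcomm G x z = gcomm G y z \<longleftrightarrow> (x \<otimes> inv y) \<otimes> z = z \<otimes> (x \<otimes> inv y)"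
proof -
  have "gcomm G x z = gcomm G y z \<longleftrightarrow> inv x \<otimes> (inv z \<otimes> x) \<otimes> z = inv y \<otimes> (inv z \<otimes> y) \<otimes> z"
    using assms by (simp add: gcomm_def m_assoc)
  also have "\<dots> \<longleftrightarrow> inv x \<otimes> (inv z \<otimes> x) = inv y \<otimes> (inv z \<otimes> y)"
    using assms by (intro right_cancel) auto
  also have "\<dots> \<longleftrightarrow> inv (inv x \<otimes> (inv z \<otimes> x)) = inv (inv y \<otimes> (inv z \<otimes> y))"
    using assms by (intro inj_on_eq_iff[symmetric, OF inv_inj]) auto
  also have "\<dots> \<longleftrightarrow> inv x \<otimes> (z \<otimes> x) = inv y \<otimes> (z \<otimes> y)"
    using assms by (simp add: inv_mult_group m_assoc)
  also have "\<dots> \<longleftrightarrow> x \<otimes> (inv x \<otimes> (z \<otimes> x)) = x \<otimes> (inv y \<otimes> (z \<otimes> y))"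
    using assms by (intro Units_l_cancel[symmetric]) auto
  also have "\<dots> \<longleftrightarrow> x \<otimes> (inv x \<otimes> (z \<otimes> x)) \<otimes> inv y = x \<otimes> (inv y \<otimes> (z \<otimes> y)) \<otimes> inv y"
    using assms by (intro right_cancel[symmetric]) auto
  also have "x \<otimes> (inv x \<otimes> (z \<otimes> x)) \<otimes> inv y = z \<otimes> (x \<otimes> inv y)"
    using assms by (simp add: m_assoc mult_inv_cancel)
  also have "x \<otimes> (inv y \<otimes> (z \<otimes> y)) \<otimes> inv y = (x \<otimes> inv y) \<otimes> z"
    using assms by (simp add: m_assoc)
  finally show ?thesis by auto
qed

lemma inv_gcomm:
  assumes "x \<in> carrier G" "y \<in> carrier G"
  shows "inv (gcomm G x y) = gcomm G y x"
  using assms by (simp add: gcomm_def inv_mult_group m_assoc)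

text \<open>Inversion swaps the entries of a commutator. This reduces a change in the second copy of
  the word to a change in the first.\<close>

lemma gcomm_eq_right_iff:
  assumes "x \<in> carrier G" "y \<in> carrier G" "z \<in> carrier G"
  shows "gcomm G z x = gcomm G z y \<longleftrightarrow> gcomm G x z = gcomm G y z"
  using inv_gcomm assms by metis

text \<open>The set of values of \<open>w\<close> is stable under endomorphisms, in particular under
  conjugation, so its centralizer is normal.\<close>

lemma word_centralizer_normal: "word_centralizer G w \<lhd> G"
proof (rule normal_invI, rule subgroupI)
  let ?C = "word_centralizer G w"
  have cl: "eval_gword G g w \<in> carrier G" if "g \<in> UNIV \<rightarrow> carrier G" for g
    using that by (intro eval_gword_closed is_group)
  show "?C \<subseteq> carrier G" by (auto simp: word_centralizer_def)
  have "\<one> \<in> ?C" using cl by (auto simp: word_centralizer_def)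
  then show "?C \<noteq> {}" by auto
  show "inv a \<in> ?C" if "a \<in> ?C" for a
    using that cl commute_inv by (auto simp: word_centralizer_def)
  show "a \<otimes> b \<in> ?C" if "a \<in> ?C" "b \<in> ?C" for a b
    unfolding word_centralizer_def
  proof (intro CollectI conjI ballI)
    show "a \<otimes> b \<in> carrier G" using that by (auto simp: word_centralizer_def)
    fix g :: "nat \<Rightarrow> 'a" assume g: "g \<in> UNIV \<rightarrow> carrier G"
    have "a \<in> carrier G" "b \<in> carrier G"
      "a \<otimes> eval_gword G g w = eval_gword G g w \<otimes> a"
      "b \<otimes> eval_gword G g w = eval_gword G g w \<otimes> b"
      using that g by (auto simp: word_centralizer_def)
    then show "a \<otimes> b \<otimes> eval_gword G g w = eval_gword G g w \<otimes> (a \<otimes> b)"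
      using cl[OF g] by (metis m_assoc)
  qed
  fix x a assume x: "x \<in> carrier G" and a: "a \<in> ?C"
  then have ac: "a \<in> carrier G" by (auto simp: word_centralizer_def)
  \<comment> \<open>This conjugation sends \<open>x \<otimes> a \<otimes> inv x\<close> to
    \<open>a\<close> and values of \<open>w\<close> to values of \<open>w\<close>. As it is
    injective, the commutation may be checked after applying it.\<close>
  define c where "c = (\<lambda>y. inv x \<otimes> y \<otimes> x)"
  have c_mult: "c (y \<otimes> z) = c y \<otimes> c z" and c_inj: "c y = c z \<Longrightarrow> y = z"
    if "y \<in> carrier G" "z \<in> carrier G" for y z
    using x that by (simp_all add: c_def m_assoc mult_inv_cancel)
  have hom: "group_hom G G c"
    by unfold_locales (use c_mult x in \<open>auto simp: hom_def c_def\<close>)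
  show "x \<otimes> a \<otimes> inv x \<in> ?C"
    unfolding word_centralizer_def
  proof (intro CollectI conjI ballI)
    show "x \<otimes> a \<otimes> inv x \<in> carrier G" using x ac by simp
    fix g :: "nat \<Rightarrow> 'a" assume g: "g \<in> UNIV \<rightarrow> carrier G"
    let ?z = "eval_gword G g w"
    have "c \<circ> g \<in> UNIV \<rightarrow> carrier G" using g x by (auto simp: c_def Pi_iff)
    then have "a \<otimes> c ?z = c ?z \<otimes> a"
      unfolding eval_gword_hom[OF hom g] using a by (auto simp: word_centralizer_def)
    moreover have "c (x \<otimes> a \<otimes> inv x) = a" using x ac by (simp add: c_def m_assoc mult_inv_cancel)
    ultimately have "c (x \<otimes> a \<otimes> inv x \<otimes> ?z) = c (?z \<otimes> (x \<otimes> a \<otimes> inv x))"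
      using c_mult[of "x \<otimes> a \<otimes> inv x" ?z] c_mult[of ?z "x \<otimes> a \<otimes> inv x"] x ac cl[OF g]
      by (metis inv_closed m_closed)
    then show "x \<otimes> a \<otimes> inv x \<otimes> ?z = ?z \<otimes> (x \<otimes> a \<otimes> inv x)"
      by (rule c_inj[rotated 2]) (use x ac cl[OF g] in simp_all)
  qed
qed

lemma normal_r_coset_eq_iff:
  assumes "N \<lhd> G" "x \<in> carrier G" "y \<in> carrier G"
  shows "N #> x = N #> y \<longleftrightarrow> x \<otimes> inv y \<in> N"
proof -
  interpret N: normal N G by fact
  have N: "N \<subseteq> carrier G" by (rule N.subset)
  have xy: "x \<otimes> inv y \<in> carrier G" using assms by simp
  have "N #> x = N #> y \<longleftrightarrow> N #> (x \<otimes> inv y) = N"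
    using coset_mult_inv1[OF _ assms(2,3) N] coset_mult_inv2[OF _ assms(2,3) N] by metis
  also have "\<dots> \<longleftrightarrow> x \<otimes> inv y \<in> N"
    using coset_join1[OF _ xy N.subgroup_axioms] coset_join2[OF xy N.subgroup_axioms] by metis
  finally show ?thesis .
qed

section \<open>Comparison of the marginal subgroups of \<open>[w, w']\<close> and
  \<open>w\<close>\<close>

lemma gcomm_eq_values_iff:
  assumes "x \<in> carrier G" "y \<in> carrier G"
  shows "(\<forall>g\<in>UNIV \<rightarrow> carrier G. gcomm G x (eval_gword G g w) = gcomm G y (eval_gword G g w)) \<longleftrightarrow>
    word_centralizer G w #> x = word_centralizer G w #> y"
  unfolding normal_r_coset_eq_iff[OF word_centralizer_normal assms]
  using assms gcomm_eq_left_iff[OF assms eval_gword_closed[OF is_group]]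
  by (auto simp: word_centralizer_def)

text \<open>The hypotheses on \<open>f\<close> make the two copies of \<open>w\<close> share no
  variable, so that their values can be chosen independently. Both sides are shown equivalent to
  \<open>?R\<close>: multiplying one variable of \<open>w\<close> by \<open>a\<close> changes the
  value of \<open>w\<close> only modulo \<open>C\<close>.\<close>

lemma marginal_comm_gword_iff:
  fixes w :: "nat gword"
  assumes f: "inj f" "f ` set_gword w \<inter> set_gword w = {}" and a: "a \<in> carrier G"
  defines "C \<equiv> word_centralizer G w"
  shows "a \<in> marginal {comm_gword w (map_gword f w)} G \<longleftrightarrow> C #> a \<in> marginal {w} (G Mod C)"
proof -
  interpret C: normal C G unfolding C_def by (rule word_centralizer_normal)
  let ?q = "\<lambda>x. C #> x" and ?ev = "\<lambda>g. eval_gword G g w"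
  have q: "group_hom G (G Mod C) ?q"
    by (intro group_hom.intro group_hom_axioms.intro is_group C.factorgroup_is_group
        C.r_coset_hom_Mod)
  have cl: "?ev g \<in> carrier G" if "g \<in> UNIV \<rightarrow> carrier G" for g
    using that by (intro eval_gword_closed is_group)
  have upd: "g(i := g i \<otimes> a) \<in> UNIV \<rightarrow> carrier G" if "g \<in> UNIV \<rightarrow> carrier G"
    for g :: "nat \<Rightarrow> 'a" and i
    using that a by (auto simp: Pi_iff)
  have evc: "eval_gword G g (comm_gword w (map_gword f w)) = gcomm G (?ev g) (?ev (g \<circ> f))" for g
    by (simp add: eval_comm_gword eval_map_gword)
  let ?R = "\<forall>g\<in>UNIV \<rightarrow> carrier G. \<forall>i\<in>set_gword w. ?q (?ev (g(i := g i \<otimes> a))) = ?q (?ev g)"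
  have "?q a \<in> marginal {w} (G Mod C) \<longleftrightarrow> ?R"
  proof
    assume L: "?q a \<in> marginal {w} (G Mod C)"
    show ?R
    proof (intro ballI)
      fix g :: "nat \<Rightarrow> 'a" and i assume g: "g \<in> UNIV \<rightarrow> carrier G" and i: "i \<in> set_gword w"
      have eq: "?q \<circ> g(i := g i \<otimes> a) = (?q \<circ> g)(i := (?q \<circ> g) i \<otimes>\<^bsub>G Mod C\<^esub> ?q a)"
        using g a group_hom.hom_mult[OF q] by (auto simp: fun_eq_iff Pi_iff)
      have "?q \<circ> g \<in> UNIV \<rightarrow> carrier (G Mod C)"
        using g group_hom.hom_closed[OF q] by (auto simp: Pi_iff)
      then show "?q (?ev (g(i := g i \<otimes> a))) = ?q (?ev g)"
        unfolding eval_gword_hom[OF q g] eval_gword_hom[OF q upd[OF g]] eq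
        using L i unfolding marginal_def by blast
    qed
  next
    assume R: ?R
    show "?q a \<in> marginal {w} (G Mod C)"
      unfolding marginal_def
    proof (intro CollectI conjI ballI)
      show "?q a \<in> carrier (G Mod C)" using a group_hom.hom_closed[OF q] by auto
      fix v and g :: "nat \<Rightarrow> 'a set" and i
      assume v: "v \<in> {w}" and g: "g \<in> UNIV \<rightarrow> carrier (G Mod C)" and i: "i \<in> set_gword v"
      \<comment> \<open>An assignment in the quotient lifts to \<open>G\<close>, one representative
        per variable, and \<open>?R\<close> applies to the lift.\<close>
      have "\<forall>j. \<exists>x\<in>carrier G. g j = ?q x"
        using g by (auto simp: Pi_iff FactGroup_def RCOSETS_def)
      then obtain h where h: "h \<in> UNIV \<rightarrow> carrier G" and gh: "g = ?q \<circ> h"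
        by (auto simp: fun_eq_iff Pi_iff choice_iff Bex_def)
      have eq: "?q \<circ> h(i := h i \<otimes> a) = g(i := g i \<otimes>\<^bsub>G Mod C\<^esub> ?q a)"
        unfolding gh using h a group_hom.hom_mult[OF q] by (auto simp: fun_eq_iff Pi_iff)
      have "?q (?ev (h(i := h i \<otimes> a))) = ?q (?ev h)" using R h i v by auto
      then show "eval_gword (G Mod C) (g(i := g i \<otimes>\<^bsub>G Mod C\<^esub> ?q a)) v = eval_gword (G Mod C) g v"
        using v unfolding eval_gword_hom[OF q h] eval_gword_hom[OF q upd[OF h]] eq gh[symmetric]
        by simp
    qed
  qed
  also have "?R \<longleftrightarrow> a \<in> marginal {comm_gword w (map_gword f w)} G"
  proof
    assume R: ?R
    \<comment> \<open>The second assignment \<open>h\<close> is unrelated to \<open>g\<close>, so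
      this serves for a changed variable in either copy.\<close>
    have gc: "gcomm G (?ev (g(i := g i \<otimes> a))) (?ev h) = gcomm G (?ev g) (?ev h)"
      if "g \<in> UNIV \<rightarrow> carrier G" "h \<in> UNIV \<rightarrow> carrier G" "i \<in> set_gword w" for g h i
      using R that gcomm_eq_values_iff[OF cl[OF upd[OF that(1)]] cl[OF that(1)], where w = w]
      unfolding C_def by blast
    show "a \<in> marginal {comm_gword w (map_gword f w)} G"
      unfolding marginal_def
    proof (intro CollectI conjI ballI)
      fix v and g :: "nat \<Rightarrow> 'a" and i
      assume v: "v \<in> {comm_gword w (map_gword f w)}" and g: "g \<in> UNIV \<rightarrow> carrier G"
        and i: "i \<in> set_gword v"
      let ?g = "g(i := g i \<otimes> a)"
      have gf: "g \<circ> f \<in> UNIV \<rightarrow> carrier G" using g by auto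
      from i v consider "i \<in> set_gword w" | j where "i = f j" "j \<in> set_gword w"
        by (auto simp: set_comm_gword gword.set_map)
      then have "gcomm G (?ev ?g) (?ev (?g \<circ> f)) = gcomm G (?ev g) (?ev (g \<circ> f))"
      proof cases
        case 1
        then have "?ev (?g \<circ> f) = ?ev (g \<circ> f)" using f(2) by (intro eval_gword_cong) auto
        then show ?thesis using gc[OF g gf 1] by simp
      next
        case 2
        \<comment> \<open>Now the changed variable lies in the renamed copy: the first entry stays
          fixed, and \<open>gc\<close> is used with the two entries exchanged.\<close>
        have "?ev ?g = ?ev g" using f(2) 2 by (intro eval_gword_cong) auto
        moreover have "?g \<circ> f = (g \<circ> f)(j := (g \<circ> f) j \<otimes> a)"
          using f(1) 2 by (auto simp: fun_eq_iff inj_eq)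
        ultimately show ?thesis
          using gc[OF gf g 2(2)] gcomm_eq_right_iff[OF cl[OF upd[OF gf, of j]] cl[OF gf] cl[OF g]]
          by simp
      qed
      then show "eval_gword G ?g v = eval_gword G g v" using v by (simp add: evc)
    qed (rule a)
  next
    assume L: "a \<in> marginal {comm_gword w (map_gword f w)} G"
    show ?R
    proof (intro ballI)
      fix g :: "nat \<Rightarrow> 'a" and i assume g: "g \<in> UNIV \<rightarrow> carrier G" and i: "i \<in> set_gword w"
      let ?g = "g(i := g i \<otimes> a)"
      have "gcomm G (?ev ?g) (?ev h) = gcomm G (?ev g) (?ev h)"
        if h: "h \<in> UNIV \<rightarrow> carrier G" for h
      proof -
        \<comment> \<open>This glues \<open>g\<close> on the variables of \<open>w\<close> to
          \<open>h\<close> on those of the copy, so \<open>k\<close> gives the commutator the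
          entries \<open>?ev g\<close> and \<open>?ev h\<close>. Changing \<open>k\<close> at
          \<open>i\<close> leaves the second entry alone.\<close>
        define k where "k = (\<lambda>j. if j \<in> set_gword w then g j else h (inv_into UNIV f j))"
        let ?k = "k(i := k i \<otimes> a)"
        have k: "k \<in> UNIV \<rightarrow> carrier G" using g h by (auto simp: k_def Pi_iff)
        have 1: "?ev k = ?ev g" "?ev ?k = ?ev ?g"
          by (intro eval_gword_cong; use i in \<open>simp add: k_def\<close>)+
        have 2: "?ev (k \<circ> f) = ?ev h" "?ev (?k \<circ> f) = ?ev h"
          by (intro eval_gword_cong; use i f in \<open>auto simp: k_def\<close>)+
        have "eval_gword G ?k (comm_gword w (map_gword f w))
            = eval_gword G k (comm_gword w (map_gword f w))"
          using L k i unfolding marginal_def by (auto simp: set_comm_gword)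
        then show ?thesis unfolding evc 1 2 .
      qed
      then show "?q (?ev ?g) = ?q (?ev g)"
        using gcomm_eq_values_iff[OF cl[OF upd[OF g]] cl[OF g], where w = w] unfolding C_def by blast
    qed
  qed
  finally show ?thesis by simp
qed

end

section \<open>Passage to the quotients and capability\<close>

lemma Mod_marginal_iso:
  assumes q: "group_hom E F q" and surj: "q ` carrier E = carrier F"
    and iff: "\<And>a. a \<in> carrier E \<Longrightarrow> a \<in> marginal V E \<longleftrightarrow> q a \<in> marginal W F"
  shows "E Mod marginal V E \<cong> F Mod marginal W F"
proof -
  interpret q: group_hom E F q by fact
  let ?M = "marginal W F"
  interpret M: normal ?M F by (rule marginal_normal) (rule q.H.is_group)
  \<comment> \<open>The first isomorphism theorem is applied to this composite: it is surjective
    because \<open>q\<close> is, and by \<open>iff\<close> its kernel is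
    \<open>marginal V E\<close>.\<close>
  let ?r = "(\<lambda>x. ?M #>\<^bsub>F\<^esub> x) \<circ> q"
  have "?r \<in> hom E (F Mod ?M)"
    using q.homh M.r_coset_hom_Mod by (rule hom_compose)
  then interpret r: group_hom E "F Mod ?M" ?r
    by (intro group_hom.intro group_hom_axioms.intro q.G.is_group M.factorgroup_is_group)
  have "?r ` carrier E = carrier (F Mod ?M)"
    unfolding image_comp[symmetric] surj by (auto simp: FactGroup_def RCOSETS_def)
  then have "E Mod kernel E (F Mod ?M) ?r \<cong> F Mod ?M" by (rule r.FactGroup_iso)
  moreover have "kernel E (F Mod ?M) ?r = marginal V E"
  proof -
    have "?M #>\<^bsub>F\<^esub> q a = ?M \<longleftrightarrow> a \<in> marginal V E" if a: "a \<in> carrier E" for a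
      using q.H.normal_r_coset_eq_iff[OF M.normal_axioms, of "q a" "\<one>\<^bsub>F\<^esub>"] a M.subset
      by (simp add: iff)
    moreover have "marginal V E \<subseteq> carrier E" by (auto simp: marginal_def)
    ultimately show ?thesis by (auto simp: kernel_def)
  qed
  ultimately show ?thesis by simp
qed

text \<open>If \<open>E\<close> witnesses capability for \<open>[w, w']\<close>, then its quotient
  by the centralizer of the values of \<open>w\<close> is a witness for \<open>w\<close>.\<close>

lemma capable_comm_gword:
  assumes G: "group G" and f: "inj f" "f ` set_gword w \<inter> set_gword w = {}"
    and cap: "capable {comm_gword w (map_gword f w)} G"
  shows "capable {w} G"
proof -
  from cap obtain E :: "('a + nat) monoid"
    where E: "group E" and iso: "G \<cong> E Mod marginal {comm_gword w (map_gword f w)} E"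
    unfolding capable_def by blast
  interpret E: group E by fact
  let ?C = "word_centralizer E w"
  interpret C: normal ?C E by (rule E.word_centralizer_normal)
  have F: "group (E Mod ?C)" by (rule C.factorgroup_is_group)
  have "E Mod marginal {comm_gword w (map_gword f w)} E \<cong> (E Mod ?C) Mod marginal {w} (E Mod ?C)"
  proof (rule Mod_marginal_iso)
    show "group_hom E (E Mod ?C) (\<lambda>x. ?C #>\<^bsub>E\<^esub> x)"
      by (intro group_hom.intro group_hom_axioms.intro E F C.r_coset_hom_Mod)
    show "(\<lambda>x. ?C #>\<^bsub>E\<^esub> x) ` carrier E = carrier (E Mod ?C)"
      by (auto simp: FactGroup_def RCOSETS_def)
  qed (rule E.marginal_comm_gword_iff[OF f])
  with iso have "G \<cong> (E Mod ?C) Mod marginal {w} (E Mod ?C)"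
    by (rule iso_trans)
  \<comment> \<open>The elements of the new witness are cosets, hence of type
    \<open>('a + nat) set\<close>; \<open>capableI\<close> replaces it by a witness over
    \<open>'a + nat\<close>.\<close>
  then show ?thesis by (rule capableI[OF G F])
qed

theorem theorem4p1:
  fixes G :: "('a, 'm) monoid_scheme" and l :: nat
  assumes "l \<ge> 2" and "group G" and "capable (solvable_words l) G"
  shows "capable (solvable_words (l - 1)) G"
proof -
  obtain k where l: "l = Suc k" using assms(1) by (cases l) auto
  \<comment> \<open>Here \<open>w\<close> is \<open>delta_word k\<close> and \<open>f\<close> is the
    shift by \<open>2 ^ k\<close>, which moves the variables \<open>{..<2 ^ k}\<close> off
    themselves.\<close>
  show ?thesis
    using assms(3) unfolding l solvable_words_def diff_Suc_1 delta_word.simps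
    by (rule capable_comm_gword[OF assms(2), rotated -1]) (auto simp: set_delta_word inj_def)
qed

end
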